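(* Let $\eta$ and $f_0<f_1$ be positive integers with $\gcd(f_0,f_1)=1$, and let $\{f_n\}$ be the binary recurrence sequence given by $$f_n=\eta f_{n-1}+f_{n-2}\qquad(n\ge2).$$ Consider the hyperbolic Pascal triangle linked to $\{4,5\}$. Then: (i) the values $f_0$ and $f_1$ appear next to each other in a suitable row, in such a way that the vertex labelled $f_1$ has type $A$; (ii) for such neighbouring vertices $W_0$ (labelled $f_0$) and $W_1$ (labelled $f_1$, of type $A$), there are vertices $W_2,W_3,\dots$ such that for every $j\ge2$ the vertex $W_j$ is labelled $f_j$, has type $A$ and is a descendant of $W_1$, and for every $j\ge1$ the distance of $W_j$ and $W_{j+1}$ is $\eta$.
   Context: The hyperbolic Pascal triangle linked to $\{4,5\}$ is built on an infinite graph ${\mathcal I}_{4,5}$ (cut out of the regular hyperbolic mosaic with Schläfli symbol $\{4,5\}$), whose vertices are arranged in rows $0,1,2,\dots$, each row ordered from left to right, and whose edges join only vertices of consecutive rows. It is constructed as follows. Row $0$ consists of a single vertex $V_0$. Row $1$ consists of two vertices, both joined to $V_0$. For every $j\ge1$ the leftmost and rightmost vertices of row $j$ are called wingers; every other vertex has type $A$ or type $B$. Given row $j\ge 1$, row $j+1$ is obtained by drawing from each vertex of row $j$, in left-to-right order, downward edges: $2$ from a winger, $3$ from a vertex of type $A$, $4$ from a vertex of type $B$. For any two neighbouring vertices of row $j$, the last downward edge of the left one and the first downward edge of the right one end in one common vertex of row $j+1$, which has type $A$. Each of the remaining downward edges ends in its own separate vertex of row $j+1$; among these, the end of the first edge of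 the leftmost vertex and the end of the last edge of the rightmost vertex are the wingers of row $j+1$, and all the others have type $B$. The left-to-right order of row $j+1$ is the order of the edges. Each vertex is labelled by the number of distinct shortest paths from $V_0$ to it; equivalently, $V_0$ has label $1$ and the label of any other vertex is the sum of the labels of its (one or two) neighbours in the previous row. Two vertices are next to each other (neighbours in a row) if they are consecutive in the left-to-right order of the same row. A vertex $W'$ is a descendant of $W$ if it can be reached from $W$ by a path of downward edges. All edges have unit length and distance is the graph distance. *)

theory Defs
  imports Main
begin

datatype vertex_type = Apex | Winger | Type_A | Type_B

fun down_degree :: "vertex_type \<Rightarrow> nat" where
  "down_degree Apex = 2"
| "down_degree Winger = 2"
| "down_degree Type_A = 3"
| "down_degree Type_B = 4"

text \<open>
  A row is the list of the types of its vertices, from left to right. The last downward edge of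
  a vertex and the first downward edge of its right neighbour end in one common vertex, so a
  vertex with \<open>d\<close> downward edges moves the end of the first edge on by \<open>d - 1\<close> positions:
  edge number \<open>k < d\<close> of vertex number \<open>i\<close> ends in position \<open>first_end ts i + k\<close> of the next
  row. The last position of the next row is \<open>first_end ts (length ts)\<close>, and the positions
  \<open>first_end ts i\<close> with \<open>0 < i < length ts\<close> are exactly the shared ends.
\<close>

definition first_end :: "vertex_type list \<Rightarrow> nat \<Rightarrow> nat" where
  "first_end ts i = (\<Sum>k<i. down_degree (ts ! k) - 1)"

definition next_row :: "vertex_type list \<Rightarrow> vertex_type list" where
  "next_row ts = map
     (\<lambda>m. if m = 0 \<or> m = first_end ts (length ts) then Winger
          else if \<exists>i. 0 < i \<and> i < length ts \<and> m = first_end ts i then Type_A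
          else Type_B)
     [0..<Suc (first_end ts (length ts))]"

fun row :: "nat \<Rightarrow> vertex_type list" where
  "row 0 = [Apex]"
| "row (Suc j) = next_row (row j)"

text \<open>The pair \<open>(j, i)\<close> is the vertex in position \<open>i\<close> (counted from 0) of row \<open>j\<close>.\<close>

type_synonym vertex = "nat \<times> nat"

definition vertices :: "vertex set" where
  "vertices = {(j, i). i < length (row j)}"

definition apex :: vertex where
  "apex = (0, 0)"

definition type_of :: "vertex \<Rightarrow> vertex_type" where
  "type_of v = row (fst v) ! snd v"

definition neighbours :: "vertex \<Rightarrow> vertex \<Rightarrow> bool" where
  "neighbours v w \<longleftrightarrow> v \<in> vertices \<and> w \<in> vertices \<and> fst v = fst w \<and>
     (snd w = Suc (snd v) \<or> snd v = Suc (snd w))"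

definition down_edges :: "(vertex \<times> vertex) set" where
  "down_edges = {((j, i), (Suc j, first_end (row j) i + k)) | j i k.
     i < length (row j) \<and> k < down_degree (row j ! i)}"

definition descendant :: "vertex \<Rightarrow> vertex \<Rightarrow> bool" where
  "descendant w w' \<longleftrightarrow> (w, w') \<in> down_edges\<^sup>+"

definition adjacent :: "vertex \<Rightarrow> vertex \<Rightarrow> bool" where
  "adjacent v w \<longleftrightarrow> (v, w) \<in> down_edges \<or> (w, v) \<in> down_edges"

definition walk :: "vertex \<Rightarrow> vertex list \<Rightarrow> vertex \<Rightarrow> bool" where
  "walk u vs w \<longleftrightarrow> vs \<noteq> [] \<and> hd vs = u \<and> last vs = w \<and> set vs \<subseteq> vertices \<and>
     successively adjacent vs"

definition graph_dist :: "vertex \<Rightarrow> vertex \<Rightarrow> nat" where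
  "graph_dist u w = (LEAST n. \<exists>vs. walk u vs w \<and> length vs = Suc n)"

definition shortest_paths :: "vertex \<Rightarrow> vertex \<Rightarrow> vertex list set" where
  "shortest_paths u w = {vs. walk u vs w \<and> length vs = Suc (graph_dist u w)}"

definition label :: "vertex \<Rightarrow> nat" where
  "label v = card (shortest_paths apex v)"

end

theory Submission
  imports Defs
begin

text \<open>
  Let \<open>v\<close> and \<open>w\<close> be neighbouring vertices. Their common child \<open>c\<close> has type A and the label
  \<open>label v + label w\<close>. The child \<open>d\<close> of \<open>w\<close> that lies next to \<open>c\<close> has no other parent, because
  only a winger has as few as two downward edges; so \<open>d\<close> repeats the label of \<open>w\<close>
  (\<open>common_child\<close>). Thus \<open>c\<close> and \<open>d\<close> are again neighbours, and repeating the step with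
  \<open>c\<close> and \<open>d\<close> in the roles of \<open>v\<close> and \<open>w\<close> adds \<open>label w\<close> once more: \<open>q\<close> steps lead from the
  labels \<open>(x, y)\<close> to neighbours labelled \<open>(y, x + q * y)\<close>, both of them \<open>q\<close> rows below \<open>w\<close>, and
  the second of type A (\<open>euclidean_step\<close>).

  This step, with \<open>q = \<eta>\<close>, is the recurrence, and iterating it gives the vertices of part (ii).
  The same step inverts the division \<open>b = q * a + r\<close>, so that running the Euclidean algorithm on
  \<open>f 0\<close> and \<open>f 1\<close> backwards, from the two wingers labelled 1 in row 1, gives part (i).

  Both parts rest on the facts that an edge changes the row by one and that every vertex is
  reached from above. Hence a downward path is a shortest one, the shortest paths from the apex
  are the downward ones, and labels add up over the parents of a vertex (\<open>label_eq_sum_parents\<close>).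
\<close>

section \<open>Positions and parents\<close>

lemma down_degree_ge_2: "2 \<le> down_degree t"
  by (cases t) auto

lemma first_end_0 [simp]: "first_end ts 0 = 0"
  by (simp add: first_end_def)

lemma first_end_Suc: "first_end ts (Suc i) = first_end ts i + (down_degree (ts ! i) - 1)"
  by (simp add: first_end_def)

lemma strict_mono_first_end: "strict_mono (first_end ts)"
proof -
  have "first_end ts i < first_end ts (Suc i)" for i
    using down_degree_ge_2[of "ts ! i"] by (simp add: first_end_Suc)
  then show ?thesis by (simp add: strict_mono_Suc_iff)
qed

lemmas first_end_less_iff [simp] = strict_mono_less[OF strict_mono_first_end]
lemmas first_end_le_iff [simp] = strict_mono_less_eq[OF strict_mono_first_end]
lemmas first_end_eq_iff [simp] = strict_mono_eq[OF strict_mono_first_end]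

lemma length_row_Suc: "length (row (Suc j)) = Suc (first_end (row j) (length (row j)))"
  by (simp add: next_row_def)

lemma nth_row_Suc:
  assumes "m \<le> first_end (row j) (length (row j))"
  shows "row (Suc j) ! m =
    (if m = 0 \<or> m = first_end (row j) (length (row j)) then Winger
     else if \<exists>i. 0 < i \<and> i < length (row j) \<and> m = first_end (row j) i then Type_A
     else Type_B)"
  using assms by (simp add: next_row_def del: upt_Suc)

declare row.simps(2) [simp del]

lemma row_nonempty: "0 < length (row j)"
  by (cases j) (simp_all add: length_row_Suc)

lemma down_degree_eq_2_at_end:
  assumes "i < length (row j)" and "down_degree (row j ! i) = 2"
  shows "i = 0 \<or> Suc i = length (row j)"
proof (cases j)
  case 0
  then show ?thesis using assms by simp
next
  case (Suc j')
  then show ?thesis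
    using assms by (auto simp: length_row_Suc nth_row_Suc less_Suc_eq_le split: if_splits)
qed

lemma down_edge_iff:
  "((j, i), (j', m)) \<in> down_edges \<longleftrightarrow> j' = Suc j \<and> i < length (row j) \<and>
     first_end (row j) i \<le> m \<and> m \<le> first_end (row j) (Suc i)"
proof -
  have "(\<exists>k < down_degree (row j ! i). m = first_end (row j) i + k) \<longleftrightarrow>
      first_end (row j) i \<le> m \<and> m \<le> first_end (row j) (Suc i)"
    using down_degree_ge_2[of "row j ! i"]
    by (auto simp: first_end_Suc intro!: exI[of _ "m - first_end (row j) i"])
  then show ?thesis
    by (auto simp: down_edges_def)
qed

lemma down_edge_fst: "(u, w) \<in> down_edges \<Longrightarrow> fst w = Suc (fst u)"
  by (auto simp: down_edges_def)

lemma down_edge_vertices: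
  assumes "(u, w) \<in> down_edges"
  shows "u \<in> vertices" and "w \<in> vertices"
proof -
  obtain j i j' m where [simp]: "u = (j, i)" "w = (j', m)"
    by (metis surj_pair)
  have "i < length (row j)" and "m \<le> first_end (row j) (Suc i)" and [simp]: "j' = Suc j"
    using assms by (auto simp: down_edge_iff)
  moreover have "first_end (row j) (Suc i) \<le> first_end (row j) (length (row j))"
    using \<open>i < length (row j)\<close> by simp
  ultimately have "m \<le> first_end (row j) (length (row j))"
    by linarith
  then show "u \<in> vertices" and "w \<in> vertices"
    using \<open>i < length (row j)\<close> by (auto simp: vertices_def length_row_Suc less_Suc_eq_le)
qed

lemma parent_exists:
  assumes "(Suc j, m) \<in> vertices"
  shows "\<exists>i. ((j, i), (Suc j, m)) \<in> down_edges"
proof -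
  let ?F = "first_end (row j)" and ?n = "length (row j)"
  have le: "m \<le> ?F ?n"
    using assms by (simp add: vertices_def length_row_Suc less_Suc_eq_le)
  define i where "i = (LEAST i. m \<le> ?F (Suc i))"
  have "m \<le> ?F (Suc (?n - 1))"
    using le row_nonempty[of j] by simp
  then have up: "m \<le> ?F (Suc i)" and "i \<le> ?n - 1"
    unfolding i_def by (rule LeastI, rule Least_le)
  moreover have "?F i \<le> m"
  proof (cases i)
    case (Suc i')
    then have "\<not> m \<le> ?F (Suc i')"
      unfolding i_def by (intro not_less_Least) simp
    then show ?thesis using Suc by simp
  qed simp
  moreover have "i < ?n"
    using \<open>i \<le> ?n - 1\<close> row_nonempty[of j] by linarith
  ultimately show ?thesis
    by (auto simp: down_edge_iff)
qed

abbreviation parents :: "vertex \<Rightarrow> vertex set" where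
  "parents v \<equiv> {u. (u, v) \<in> down_edges}"

lemma finite_parents: "finite (parents v)"
proof (rule finite_subset)
  show "parents v \<subseteq> Pair (fst v - 1) ` {..<length (row (fst v - 1))}"
    by (cases v) (auto simp: down_edge_iff)
qed simp

lemma parents_shared:
  assumes "Suc i < length (row j)"
  shows "parents (Suc j, first_end (row j) (Suc i)) = {(j, i), (j, Suc i)}"
proof -
  have "((j', i'), (Suc j, first_end (row j) (Suc i))) \<in> down_edges \<longleftrightarrow>
      j' = j \<and> (i' = i \<or> i' = Suc i)" for j' i'
    using assms by (cases "j' = j") (auto simp: down_edge_iff le_Suc_eq)
  then show ?thesis by auto
qed

lemma parents_unshared:
  assumes "((j, i), (Suc j, m)) \<in> down_edges"
    and "\<And>i'. 0 < i' \<Longrightarrow> i' < length (row j) \<Longrightarrow> m \<noteq> first_end (row j) i'"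
  shows "parents (Suc j, m) = {(j, i)}"
proof -
  let ?F = "first_end (row j)"
  have eq: "i' = i" if "((j, i'), (Suc j, m)) \<in> down_edges" for i'
  proof (rule ccontr)
    assume "i' \<noteq> i"
    \<comment> \<open>Two parents must be neighbours, and \<open>m\<close> is then their shared child.\<close>
    have *: False if "a < b" "b < length (row j)" "m \<le> ?F (Suc a)" "?F b \<le> m" for a b
    proof -
      have "?F (Suc a) \<le> ?F b"
        using \<open>a < b\<close> by simp
      then have "m = ?F b"
        using that by linarith
      then show False
        using assms(2)[of b] that by simp
    qed
    have "i < length (row j)" "i' < length (row j)"
      and "m \<le> ?F (Suc i)" "?F i \<le> m" "m \<le> ?F (Suc i')" "?F i' \<le> m"
      using that assms(1) by (simp_all only: down_edge_iff)
    moreover have "i < i' \<or> i' < i"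
      using \<open>i' \<noteq> i\<close> by linarith
    ultimately show False
      using *[of i i'] *[of i' i] by blast
  qed
  show ?thesis
  proof (intro equalityI subsetI)
    fix u assume "u \<in> parents (Suc j, m)"
    then have u: "(u, (Suc j, m)) \<in> down_edges"
      by blast
    moreover have "u = (j, snd u)"
      using down_edge_fst[OF u] by (simp add: prod_eq_iff)
    ultimately have "snd u = i"
      using eq[of "snd u"] by metis
    then show "u \<in> {(j, i)}"
      using \<open>u = (j, snd u)\<close> by simp
  qed (use assms(1) in blast)
qed


section \<open>Distances and shortest paths\<close>

lemma walk_snoc:
  assumes "vs \<noteq> []"
  shows "walk u (vs @ [w]) w' \<longleftrightarrow>
    w' = w \<and> w \<in> vertices \<and> walk u vs (last vs) \<and> adjacent (last vs) w"
  using assms by (auto simp: walk_def successively_append_iff)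

text \<open>An edge changes the row by one, so a walk cannot descend faster than one row per edge.\<close>

lemma walk_fst_le: "walk u vs w \<Longrightarrow> fst w < fst u + length vs"
proof (induction vs arbitrary: w rule: rev_induct)
  case Nil
  then show ?case by (simp add: walk_def)
next
  case (snoc x vs)
  show ?case
  proof (cases "vs = []")
    case True
    then show ?thesis using snoc.prems by (auto simp: walk_def)
  next
    case False
    then have "w = x" "walk u vs (last vs)" "adjacent (last vs) x"
      using snoc.prems by (auto simp: walk_snoc)
    then show ?thesis
      using snoc.IH[of "last vs"] by (auto simp: adjacent_def dest!: down_edge_fst)
  qed
qed

lemma down_path_walk:
  assumes "(u, w) \<in> down_edges ^^ n" and "u \<in> vertices"
  shows "\<exists>vs. walk u vs w \<and> length vs = Suc n"
  using assms(1)
proof (induction n arbitrary: w)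
  case 0
  then show ?case using assms(2) by (intro exI[of _ "[u]"]) (auto simp: walk_def)
next
  case (Suc n)
  then obtain x where x: "(u, x) \<in> down_edges ^^ n" "(x, w) \<in> down_edges"
    by auto
  obtain vs where vs: "walk u vs x" "length vs = Suc n"
    using Suc.IH[OF x(1)] by blast
  then have "vs \<noteq> []" "last vs = x"
    by (auto simp: walk_def)
  then have "walk u (vs @ [w]) w"
    using vs x(2) down_edge_vertices[OF x(2)] by (auto simp: walk_snoc adjacent_def)
  then show ?case using vs(2) by (intro exI[of _ "vs @ [w]"]) auto
qed

lemma down_path_fst: "(u, w) \<in> down_edges ^^ n \<Longrightarrow> fst w = fst u + n"
  by (induction n arbitrary: w) (auto dest!: down_edge_fst)

lemma graph_dist_down_path:
  assumes "(u, w) \<in> down_edges ^^ n" and "u \<in> vertices"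
  shows "graph_dist u w = n"
  unfolding graph_dist_def
proof (rule Least_equality)
  show "\<exists>vs. walk u vs w \<and> length vs = Suc n"
    by (rule down_path_walk[OF assms])
next
  fix k assume "\<exists>vs. walk u vs w \<and> length vs = Suc k"
  then obtain vs where vs: "walk u vs w" "length vs = Suc k"
    by blast
  show "n \<le> k"
    using walk_fst_le[OF vs(1)] down_path_fst[OF assms(1)] vs(2) by linarith
qed

lemma apex_in_vertices: "apex \<in> vertices"
  by (simp add: apex_def vertices_def)

lemma vertex_below_apex:
  assumes "v \<in> vertices"
  shows "(apex, v) \<in> down_edges ^^ fst v"
proof -
  have "(apex, (j, m)) \<in> down_edges ^^ j" if "(j, m) \<in> vertices" for j m
    using that
  proof (induction j arbitrary: m)
    case 0
    then show ?case by (simp add: vertices_def apex_def)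
  next
    case (Suc j)
    then obtain i where i: "((j, i), (Suc j, m)) \<in> down_edges"
      using parent_exists by blast
    show ?case
      using Suc.IH[OF down_edge_vertices(1)[OF i]] i by auto
  qed
  then show ?thesis
    using assms by (metis prod.collapse)
qed

lemma graph_dist_apex: "v \<in> vertices \<Longrightarrow> graph_dist apex v = fst v"
  using vertex_below_apex apex_in_vertices by (rule graph_dist_down_path)

lemma shortest_paths_iff:
  assumes "v \<in> vertices"
  shows "vs \<in> shortest_paths apex v \<longleftrightarrow> walk apex vs v \<and> length vs = Suc (fst v)"
  by (simp add: shortest_paths_def graph_dist_apex[OF assms])

text \<open>
  A shortest path to a vertex in row \<open>n\<close> has \<open>n\<close> edges, so it has to descend at every edge; in
  particular it arrives from a parent.
\<close>

lemma shortest_paths_last_edge: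
  assumes "v \<in> vertices" and "0 < fst v"
  shows "shortest_paths apex v =
    (\<Union>u\<in>parents v. (\<lambda>vs. vs @ [v]) ` shortest_paths apex u)"
proof (intro equalityI subsetI)
  fix xs assume "xs \<in> shortest_paths apex v"
  then have xs: "walk apex xs v" "length xs = Suc (fst v)"
    using assms(1) by (auto simp: shortest_paths_iff)
  then obtain vs x where "xs = vs @ [x]"
    by (cases xs rule: rev_cases) auto
  moreover from this have "vs \<noteq> []"
    using xs(2) assms(2) by auto
  ultimately have vs: "xs = vs @ [v]" "walk apex vs (last vs)" "adjacent (last vs) v"
    using xs(1) by (auto simp: walk_snoc)
  have "fst (last vs) < fst v"
    using walk_fst_le[OF vs(2)] xs(2) vs(1) by (simp add: apex_def)
  then have edge: "(last vs, v) \<in> down_edges"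
    using vs(3) by (auto simp: adjacent_def dest!: down_edge_fst)
  then have "vs \<in> shortest_paths apex (last vs)"
    using vs(1,2) xs(2) down_edge_fst[OF edge]
    by (simp add: shortest_paths_iff[OF down_edge_vertices(1)[OF edge]])
  then show "xs \<in> (\<Union>u\<in>parents v. (\<lambda>vs. vs @ [v]) ` shortest_paths apex u)"
    using edge vs(1) by blast
next
  fix xs assume "xs \<in> (\<Union>u\<in>parents v. (\<lambda>vs. vs @ [v]) ` shortest_paths apex u)"
  then obtain u vs where u: "(u, v) \<in> down_edges" and vs: "vs \<in> shortest_paths apex u"
    and xs: "xs = vs @ [v]"
    by blast
  have walk: "walk apex vs u" "length vs = Suc (fst u)"
    using vs by (auto simp: shortest_paths_iff[OF down_edge_vertices(1)[OF u]])
  then have "vs \<noteq> []" "last vs = u"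
    by (auto simp: walk_def)
  then show "xs \<in> shortest_paths apex v"
    using walk xs u assms(1) down_edge_fst[OF u]
    by (auto simp: shortest_paths_iff walk_snoc adjacent_def)
qed

lemma shortest_paths_apex: "shortest_paths apex apex = {[apex]}"
proof -
  have "vs \<in> shortest_paths apex apex \<longleftrightarrow> vs = [apex]" for vs
    unfolding shortest_paths_iff[OF apex_in_vertices]
    using apex_in_vertices by (auto simp: walk_def apex_def length_Suc_conv)
  then show ?thesis by blast
qed

lemma label_apex: "label apex = 1"
  by (simp add: label_def shortest_paths_apex)

lemma finite_shortest_paths: "v \<in> vertices \<Longrightarrow> finite (shortest_paths apex v)"
proof (induction "fst v" arbitrary: v)
  case 0
  then have "v = apex"
    by (cases v) (auto simp: vertices_def apex_def)
  then show ?case by (simp add: shortest_paths_apex)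
next
  case (Suc j)
  have "finite (shortest_paths apex u)" if "(u, v) \<in> down_edges" for u
    using Suc.hyps down_edge_fst[OF that] down_edge_vertices(1)[OF that] by simp
  then show ?case
    using Suc.prems Suc.hyps(2) by (simp add: shortest_paths_last_edge finite_parents)
qed

text \<open>
  Classifying the shortest paths by their last edge turns the definition of the labels by
  counting into the additive rule of the triangle.
\<close>

lemma label_eq_sum_parents:
  assumes "v \<in> vertices" and "0 < fst v"
  shows "label v = sum label (parents v)"
proof -
  let ?S = "\<lambda>u. (\<lambda>vs. vs @ [v]) ` shortest_paths apex u"
  have last: "last vs = u" if "vs \<in> shortest_paths apex u" for vs u
    using that by (auto simp: shortest_paths_def walk_def)
  have "label v = card (\<Union>u\<in>parents v. ?S u)"
    by (simp add: label_def shortest_paths_last_edge[OF assms])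
  also have "\<dots> = (\<Sum>u\<in>parents v. card (?S u))"
  proof (rule card_UN_disjoint)
    show "finite (parents v)"
      by (rule finite_parents)
    show "\<forall>u\<in>parents v. finite (?S u)"
      using finite_shortest_paths down_edge_vertices(1) by blast
    show "\<forall>u\<in>parents v. \<forall>u'\<in>parents v. u \<noteq> u' \<longrightarrow> ?S u \<inter> ?S u' = {}"
      using last by blast
  qed
  also have "\<dots> = sum label (parents v)"
    by (simp add: label_def card_image inj_on_def)
  finally show ?thesis .
qed


section \<open>Neighbours and their common child\<close>

lemma neighbours_sym: "neighbours v w \<Longrightarrow> neighbours w v"
  by (auto simp: neighbours_def)

lemma shared_child:
  assumes "Suc i < length (row j)"
  defines "c \<equiv> (Suc j, first_end (row j) (Suc i))"
  shows "((j, i), c) \<in> down_edges" and "((j, Suc i), c) \<in> down_edges"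
    and "type_of c = Type_A" and "label c = label (j, i) + label (j, Suc i)"
proof -
  have edges: "((j, i), c) \<in> down_edges" "((j, Suc i), c) \<in> down_edges"
    using assms by (auto simp: down_edge_iff)
  then show "((j, i), c) \<in> down_edges" "((j, Suc i), c) \<in> down_edges" .
  have "first_end (row j) 0 < first_end (row j) (Suc i)"
    by (simp only: first_end_less_iff)
  moreover have "first_end (row j) (Suc i) < first_end (row j) (length (row j))"
    using assms(1) by simp
  ultimately show "type_of c = Type_A"
    using assms(1) by (auto simp: c_def type_of_def nth_row_Suc)
  have "label c = sum label (parents c)"
    using down_edge_vertices(2)[OF edges(1)] by (intro label_eq_sum_parents) (auto simp: c_def)
  then show "label c = label (j, i) + label (j, Suc i)"
    unfolding c_def parents_shared[OF assms(1)] by simp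
qed

lemma label_unshared_child:
  assumes "((j, i), (Suc j, m)) \<in> down_edges"
    and "\<And>i'. 0 < i' \<Longrightarrow> i' < length (row j) \<Longrightarrow> m \<noteq> first_end (row j) i'"
  shows "label (Suc j, m) = label (j, i)"
proof -
  have "label (Suc j, m) = sum label (parents (Suc j, m))"
    using down_edge_vertices(2)[OF assms(1)] by (intro label_eq_sum_parents) auto
  then show ?thesis
    by (simp add: parents_unshared[OF assms])
qed

text \<open>
  The two cases of the proof are mirror images: \<open>w\<close> is the right or the left one of the two
  neighbours, and \<open>d\<close> is accordingly the right or the left neighbour of \<open>c\<close>. In both, \<open>d\<close> could
  be shared with the vertex on the other side of \<open>w\<close> only if \<open>w\<close> had just two downward edges;
  but then \<open>w\<close> is at the end of its row and there is no such vertex.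
\<close>

lemma common_child:
  assumes "neighbours v w"
  shows "\<exists>c d. neighbours c d \<and> type_of c = Type_A \<and> (w, c) \<in> down_edges \<and> (w, d) \<in> down_edges \<and>
    label c = label v + label w \<and> label d = label w"
proof -
  obtain j i where
    "Suc i < length (row j)" and vw: "v = (j, i) \<and> w = (j, Suc i) \<or> v = (j, Suc i) \<and> w = (j, i)"
    using assms by (cases v; cases w) (auto simp: neighbours_def vertices_def)
  note i = this(1)
  let ?F = "first_end (row j)"
  let ?c = "(Suc j, ?F (Suc i))"
  note c = shared_child[OF i]
  from vw show ?thesis
  proof
    assume vw: "v = (j, i) \<and> w = (j, Suc i)"
    let ?m = "Suc (?F (Suc i))"
    have less: "?F (Suc i) < ?F (Suc (Suc i))"
      by simp
    then have edge: "(w, (Suc j, ?m)) \<in> down_edges"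
      using vw i by (auto simp: down_edge_iff simp del: first_end_less_iff)
    have unshared: "?m \<noteq> ?F i'" if "0 < i'" "i' < length (row j)" for i'
    proof
      assume m: "?m = ?F i'"
      then have "?F (Suc i) < ?F i'" "?F i' \<le> ?F (Suc (Suc i))"
        using less by (simp_all del: first_end_less_iff first_end_le_iff)
      then have "i' = Suc (Suc i)"
        by simp
      then have "down_degree (row j ! Suc i) = 2"
        using m down_degree_ge_2[of "row j ! Suc i"] by (simp add: first_end_Suc)
      then show False
        using down_degree_eq_2_at_end[OF i] that \<open>i' = Suc (Suc i)\<close> by simp
    qed
    have "label (Suc j, ?m) = label w"
      using label_unshared_child[of j "Suc i" ?m] edge unshared vw by blast
    moreover have "neighbours ?c (Suc j, ?m)"
      using down_edge_vertices(2)[OF c(1)] down_edge_vertices(2)[OF edge]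
      by (simp add: neighbours_def)
    ultimately show ?thesis
      using c edge vw by (intro exI[of _ ?c] exI[of _ "(Suc j, ?m)"]) auto
  next
    assume vw: "v = (j, Suc i) \<and> w = (j, i)"
    let ?m = "?F (Suc i) - 1"
    have less: "?F i < ?F (Suc i)"
      by simp
    then have edge: "(w, (Suc j, ?m)) \<in> down_edges"
      using vw i by (auto simp: down_edge_iff simp del: first_end_less_iff)
    have unshared: "?m \<noteq> ?F i'" if "0 < i'" "i' < length (row j)" for i'
    proof
      assume m: "?m = ?F i'"
      then have "?F i' < ?F (Suc i)" "?F i \<le> ?F i'"
        using less by (simp_all del: first_end_less_iff first_end_le_iff)
      then have "i' = i"
        by simp
      then have "down_degree (row j ! i) = 2"
        using m down_degree_ge_2[of "row j ! i"] by (simp add: first_end_Suc)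
      then show False
        using down_degree_eq_2_at_end[of i j] that i \<open>i' = i\<close> by simp
    qed
    have "label (Suc j, ?m) = label w"
      using label_unshared_child[of j i ?m] edge unshared vw by blast
    moreover have "neighbours ?c (Suc j, ?m)"
      using down_edge_vertices(2)[OF c(1)] down_edge_vertices(2)[OF edge] less
      by (simp add: neighbours_def del: first_end_less_iff)
    ultimately show ?thesis
      using c edge vw by (intro exI[of _ ?c] exI[of _ "(Suc j, ?m)"]) auto
  qed
qed

text \<open>
  Only \<open>d\<close> is used to descend further, since the vertex whose label is added has to stay
  \<open>label w\<close>; this is why \<open>d\<close> has to be known \<open>q\<close> rows below \<open>w\<close> as well.
\<close>

lemma euclidean_step:
  assumes "neighbours v w" and "0 < q"
  shows "\<exists>d c. neighbours d c \<and> type_of c = Type_A \<and>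
    (w, c) \<in> down_edges ^^ q \<and> (w, d) \<in> down_edges ^^ q \<and>
    label d = label w \<and> label c = q * label w + label v"
  using assms(2)
proof (induction q rule: nat_induct_non_zero)
  case 1
  obtain c d where "neighbours d c" "type_of c = Type_A" "(w, c) \<in> down_edges"
    "(w, d) \<in> down_edges" "label c = label v + label w" "label d = label w"
    using common_child[OF assms(1)] neighbours_sym by blast
  then show ?case
    by (intro exI[of _ d] exI[of _ c]) simp
next
  case (Suc q)
  then obtain d c where dc: "neighbours d c" "(w, d) \<in> down_edges ^^ q"
    "label d = label w" "label c = q * label w + label v"
    by blast
  obtain c' d' where "neighbours c' d'" "type_of c' = Type_A"
    "(d, c') \<in> down_edges" "(d, d') \<in> down_edges"
    "label c' = label c + label d" "label d' = label d"
    using common_child[OF neighbours_sym[OF dc(1)]] by blast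
  then show ?case
    using dc by (intro exI[of _ d'] exI[of _ c']) (auto dest: neighbours_sym)
qed


section \<open>Coprime pairs and recurrences\<close>

lemma row_1: "row (Suc 0) = [Winger, Winger]"
  by (simp add: row.simps next_row_def first_end_def)

lemma neighbours_labelled_1:
  "neighbours (1, 0) (1, 1)" "label (1, 0) = 1" "label (1, 1) = 1"
proof -
  show neighb: "neighbours (1, 0) (1, 1)"
    by (simp add: neighbours_def vertices_def row_1)
  have label: "label (1, m) = 1" if "m \<le> 1" for m
  proof -
    have edge: "((0, 0), (Suc 0, m)) \<in> down_edges"
      using that by (simp add: down_edge_iff first_end_Suc)
    have "label (Suc 0, m) = label (0, 0)"
      by (rule label_unshared_child[OF edge]) simp
    then show ?thesis
      using label_apex by (simp add: apex_def)
  qed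
  show "label (1, 0) = 1" "label (1, 1) = 1"
    by (rule label, simp)+
qed

text \<open>
  The Euclidean algorithm with remainders in \<open>{1..a}\<close> instead of \<open>{0..<a}\<close> stops at the pair
  \<open>(1, 1)\<close>, the labels of row 1. This pair alone does not contain a vertex of type A.
\<close>

lemma coprime_pair_occurs:
  assumes "coprime a b" and "0 < a" and "a \<le> b"
  shows "\<exists>v w. neighbours v w \<and> label v = a \<and> label w = b \<and> (a < b \<longrightarrow> type_of w = Type_A)"
  using assms
proof (induction b arbitrary: a rule: less_induct)
  case (less b)
  show ?case
  proof (cases "a = b")
    case True
    then have "a = 1" "b = 1"
      using less.prems by simp_all
    then show ?thesis
      using neighbours_labelled_1 by blast
  next
    case False
    define q r where "q = (b - 1) div a" and "r = Suc ((b - 1) mod a)"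
    have b: "b = q * a + r"
      using less.prems by (simp add: q_def r_def)
    have r: "0 < r" "r \<le> a"
      using less.prems by (simp_all add: r_def Suc_leI)
    have "0 < q"
      using less.prems False by (simp add: q_def div_greater_zero_iff)
    have "coprime r a"
      using less.prems(1) unfolding b
      by (simp add: coprime_iff_gcd_eq_1 gcd_add_mult gcd.commute)
    moreover have "a < b"
      using less.prems False by simp
    ultimately obtain v w where vw: "neighbours v w" "label v = r" "label w = a"
      using less.IH[of a r] r by blast
    show ?thesis
      using euclidean_step[OF vw(1) \<open>0 < q\<close>] vw b by auto
  qed
qed

text \<open>
  The neighbour of \<open>Q (Suc n)\<close> that carries the label of \<open>Q n\<close> is not \<open>Q n\<close> itself but a copy of
  it \<open>\<eta>\<close> rows further down. The choice therefore runs over pairs of neighbours, of which only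
  the second components form the sequence.
\<close>

lemma recurrence_descends:
  assumes "0 < \<eta>" and rec: "\<And>n. f (Suc (Suc n)) = \<eta> * f (Suc n) + f n"
    and start: "neighbours v w" "label v = f 0" "label w = f 1" "type_of w = Type_A"
  shows "\<exists>Q. Q 0 = w \<and> (\<forall>n. Q n \<in> vertices \<and> label (Q n) = f (Suc n) \<and>
    type_of (Q n) = Type_A \<and> (Q n, Q (Suc n)) \<in> down_edges ^^ \<eta>)"
proof -
  let ?P = "\<lambda>n p. neighbours (fst p) (snd p) \<and> label (fst p) = f n \<and>
    label (snd p) = f (Suc n) \<and> type_of (snd p) = Type_A \<and> (n = 0 \<longrightarrow> snd p = w)"
  let ?R = "\<lambda>_ p p'. (snd p, snd p') \<in> down_edges ^^ \<eta>"
  have "\<exists>p. \<forall>n. ?P n (p n) \<and> ?R n (p n) (p (Suc n))"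
  proof (rule dependent_nat_choice)
    show "\<exists>p. ?P 0 p"
      using start by (intro exI[of _ "(v, w)"]) simp
  next
    fix p n assume p: "?P n p"
    then obtain d c where "neighbours d c" "type_of c = Type_A"
      "(snd p, c) \<in> down_edges ^^ \<eta>" "label d = label (snd p)"
      "label c = \<eta> * label (snd p) + label (fst p)"
      using euclidean_step[OF _ assms(1)] by blast
    with p show "\<exists>p'. ?P (Suc n) p' \<and> ?R n p p'"
      by (intro exI[of _ "(d, c)"]) (simp add: rec)
  qed
  then obtain p where p: "\<And>n. ?P n (p n)" "\<And>n. ?R n (p n) (p (Suc n))"
    by blast
  have "snd (p n) \<in> vertices" for n
    using p(1)[of n] by (simp add: neighbours_def)
  then show ?thesis
    using p(1)[of 0] p by (intro exI[of _ "\<lambda>n. snd (p n)"]) simp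
qed

lemma iterated_descendant:
  assumes "0 < \<eta>" and "\<And>n. (Q n, Q (Suc n)) \<in> down_edges ^^ \<eta>"
  shows "descendant (Q 0) (Q (Suc n))"
proof -
  have step: "(Q n, Q (Suc n)) \<in> down_edges\<^sup>+" for n
    using assms trancl_power by blast
  have "(Q 0, Q (Suc n)) \<in> down_edges\<^sup>+"
  proof (induction n)
    case (Suc n)
    then show ?case using step[of "Suc n"] by (rule trancl_trans)
  qed (rule step)
  then show ?thesis by (simp add: descendant_def)
qed

theorem theorem6:
  fixes \<eta> :: nat and f :: "nat \<Rightarrow> nat"
  assumes "\<eta> > 0"
    and "f 0 > 0"
    and "f 0 < f 1"
    and "gcd (f 0) (f 1) = 1"
    and "\<And>n. n \<ge> 2 \<Longrightarrow> f n = \<eta> * f (n - 1) + f (n - 2)"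
  shows "(\<exists>W\<^sub>0 W\<^sub>1. neighbours W\<^sub>0 W\<^sub>1 \<and> label W\<^sub>0 = f 0 \<and> label W\<^sub>1 = f 1 \<and>
            type_of W\<^sub>1 = Type_A) \<and>
         (\<forall>W\<^sub>0 W\<^sub>1. neighbours W\<^sub>0 W\<^sub>1 \<and> label W\<^sub>0 = f 0 \<and> label W\<^sub>1 = f 1 \<and>
            type_of W\<^sub>1 = Type_A \<longrightarrow>
            (\<exists>W :: nat \<Rightarrow> vertex. W 0 = W\<^sub>0 \<and> W 1 = W\<^sub>1 \<and>
               (\<forall>j\<ge>2. W j \<in> vertices \<and> label (W j) = f j \<and> type_of (W j) = Type_A \<and>
                  descendant W\<^sub>1 (W j)) \<and>
               (\<forall>j\<ge>1. graph_dist (W j) (W (j + 1)) = \<eta>)))"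
proof (intro conjI allI impI)
  show "\<exists>W\<^sub>0 W\<^sub>1. neighbours W\<^sub>0 W\<^sub>1 \<and> label W\<^sub>0 = f 0 \<and> label W\<^sub>1 = f 1 \<and> type_of W\<^sub>1 = Type_A"
    using coprime_pair_occurs[of "f 0" "f 1"] assms(2-4) by (auto simp: coprime_iff_gcd_eq_1)
next
  fix W\<^sub>0 W\<^sub>1
  assume *: "neighbours W\<^sub>0 W\<^sub>1 \<and> label W\<^sub>0 = f 0 \<and> label W\<^sub>1 = f 1 \<and> type_of W\<^sub>1 = Type_A"
  have rec: "f (Suc (Suc n)) = \<eta> * f (Suc n) + f n" for n
    using assms(5)[of "Suc (Suc n)"] by simp
  have "\<exists>Q. Q 0 = W\<^sub>1 \<and> (\<forall>n. Q n \<in> vertices \<and> label (Q n) = f (Suc n) \<and>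
      type_of (Q n) = Type_A \<and> (Q n, Q (Suc n)) \<in> down_edges ^^ \<eta>)"
    by (rule recurrence_descends[where f = f and v = W\<^sub>0]) (use assms(1) rec * in simp_all)
  then obtain Q where Q: "Q 0 = W\<^sub>1" "\<And>n. Q n \<in> vertices" "\<And>n. label (Q n) = f (Suc n)"
    "\<And>n. type_of (Q n) = Type_A" and path: "\<And>n. (Q n, Q (Suc n)) \<in> down_edges ^^ \<eta>"
    by blast
  define W where "W = case_nat W\<^sub>0 Q"
  have "W j \<in> vertices \<and> label (W j) = f j \<and> type_of (W j) = Type_A \<and> descendant W\<^sub>1 (W j)"
    if j: "j \<ge> 2" for j
  proof -
    obtain n where "j = Suc (Suc n)"
      using le_Suc_ex[OF j] by auto
    moreover have "descendant W\<^sub>1 (Q (Suc n))"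
      using iterated_descendant[of \<eta> Q n] assms(1) path Q(1) by simp
    ultimately show ?thesis
      using Q(2-4) by (simp add: W_def)
  qed
  moreover have "graph_dist (W j) (W (j + 1)) = \<eta>" if "j \<ge> 1" for j
    using that graph_dist_down_path[OF path Q(2)] by (cases j) (simp_all add: W_def)
  moreover have "W 0 = W\<^sub>0" "W 1 = W\<^sub>1"
    using Q(1) by (auto simp: W_def)
  ultimately show "\<exists>W. W 0 = W\<^sub>0 \<and> W 1 = W\<^sub>1 \<and>
      (\<forall>j\<ge>2. W j \<in> vertices \<and> label (W j) = f j \<and> type_of (W j) = Type_A \<and>
         descendant W\<^sub>1 (W j)) \<and>
      (\<forall>j\<ge>1. graph_dist (W j) (W (j + 1)) = \<eta>)"
    by blast
qed

end
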